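(* For every $c>0$ and every $\delta>0$ there exist $\varepsilon>0$ and $n_0$ such that every graph $G$ on $n\ge n_0$ vertices with $\alpha(G)\ge cn$ and at most $2^{\varepsilon n}$ distinct maximum independent sets satisfies $h(G)\le\delta n$. (That is: if $G$ is an $n$-vertex graph with $\alpha(G)=\Omega(n)$ whose number of distinct maximum independent sets is $2^{o(n)}$, then $h(G)=o(n)$.)
   Context: All graphs are finite and simple. An independent set of $G$ is a set of pairwise non-adjacent vertices; a maximum independent set is one of largest possible size, and $\alpha(G)$ denotes this size. A hitting set of $G$ is a subset $T\subseteq V(G)$ with $T\cap I\neq\emptyset$ for every maximum independent set $I$ of $G$; $h(G)$ denotes the smallest size of a hitting set of $G$. *)

theory Defs
  imports Complex_Main "Graph_Theory.Pair_Digraph"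
begin

(* Finite simple graphs are the instances of the locale pair_graph: each edge uv is
   represented by the two arcs (u, v) and (v, u), and there are no loops. *)

definition independent_set :: "'a pair_pre_digraph \<Rightarrow> 'a set \<Rightarrow> bool" where
  "independent_set G I \<longleftrightarrow>
     I \<subseteq> pverts G \<and> pairwise (\<lambda>u v. (u, v) \<notin> parcs G) I"

definition independence_number :: "'a pair_pre_digraph \<Rightarrow> nat" where
  "independence_number G = Max (card ` {I. independent_set G I})"

definition maximum_independent_set :: "'a pair_pre_digraph \<Rightarrow> 'a set \<Rightarrow> bool" where
  "maximum_independent_set G I \<longleftrightarrow>
     independent_set G I \<and> card I = independence_number G"

definition hitting_set :: "'a pair_pre_digraph \<Rightarrow> 'a set \<Rightarrow> bool" where
  "hitting_set G T \<longleftrightarrow>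
     T \<subseteq> pverts G \<and> (\<forall>I. maximum_independent_set G I \<longrightarrow> T \<inter> I \<noteq> {})"

(* The minimum is over a nonempty set exactly when G has a vertex: the only maximum
   independent set of the graph without vertices is {}, which nothing hits. *)
definition hitting_number :: "'a pair_pre_digraph \<Rightarrow> nat" where
  "hitting_number G = Min (card ` {T. hitting_set G T})"

end

theory Submission
  imports Defs
begin

text \<open>A maximum independent set contains a fraction at least \<open>c\<close> of the vertices, so by
  double counting some vertex lies in a fraction at least \<open>c\<close> of any given collection of maximum
  independent sets. Greedily choosing such vertices, after \<open>t\<close> steps at most
  \<open>2 powr (\<epsilon> * n) * (1 - c) ^ t\<close> sets are not hit, and for \<open>\<epsilon> = c * \<delta> / 2\<close> this
  is below 1 when \<open>t\<close> is the integer part of \<open>\<delta> * n\<close>.\<close>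

lemma exists_popular_element:
  fixes F :: "'a set set" and c :: real
  assumes "finite V" "V \<noteq> {}" "finite F"
    and sub: "\<And>I. I \<in> F \<Longrightarrow> I \<subseteq> V"
    and large: "\<And>I. I \<in> F \<Longrightarrow> c * card V \<le> card I"
  obtains v where "v \<in> V" "c * card F \<le> card {I \<in> F. v \<in> I}"
proof -
  have "\<exists>v\<in>V. c * card F \<le> card {I \<in> F. v \<in> I}"
  proof (rule ccontr)
    assume "\<not> ?thesis"
    \<comment> \<open>If every vertex were unpopular, the incidences between \<open>V\<close> and
      \<open>F\<close> would number less than \<open>c * card V * card F\<close>; strictness needs
      \<open>V\<close> nonempty. Counting them set by set gives at least that many.\<close>
    then have "(\<Sum>v\<in>V. real (card {I \<in> F. v \<in> I})) < (\<Sum>v\<in>V. c * card F)"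
      using assms(1,2) by (intro sum_strict_mono) auto
    moreover have "(\<Sum>v\<in>V. card {I \<in> F. v \<in> I}) = (\<Sum>I\<in>F. card {v \<in> V. v \<in> I})"
      using sum_multicount_gen[OF \<open>finite V\<close> \<open>finite F\<close>, of "\<lambda>v I. v \<in> I"] by simp
    moreover have "{v \<in> V. v \<in> I} = I" if "I \<in> F" for I
      using sub[OF that] by blast
    moreover have "(\<Sum>I\<in>F. c * card V) \<le> (\<Sum>I\<in>F. real (card I))"
      by (intro sum_mono large)
    ultimately show False
      by (simp add: mult_ac flip: of_nat_sum)
  qed
  then show thesis
    using that by blast
qed

text \<open>The threshold is exponential because a greedy choice leaves at most a fraction
  \<open>1 - c\<close>, hence at most \<open>exp (- c)\<close>, of the sets unhit, which lowers
  \<open>t\<close> by exactly one. At \<open>t = 0\<close> it forces \<open>F\<close> to be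
  empty.\<close>

lemma exists_small_transversal:
  fixes F :: "'a set set" and c :: real
  assumes "finite V" "V \<noteq> {}" "finite F"
    and "\<And>I. I \<in> F \<Longrightarrow> I \<subseteq> V"
    and "\<And>I. I \<in> F \<Longrightarrow> c * card V \<le> card I"
    and "card F < exp (c * real t)"
  shows "\<exists>T\<subseteq>V. card T \<le> t \<and> (\<forall>I\<in>F. T \<inter> I \<noteq> {})"
  using assms(3-)
proof (induction t arbitrary: F)
  case 0
  then show ?case by auto
next
  case (Suc t)
  obtain v where v: "v \<in> V" "c * card F \<le> card {I \<in> F. v \<in> I}"
    using exists_popular_element[OF assms(1,2) Suc.prems(1-3)] .
  let ?F' = "{I \<in> F. v \<notin> I}"
  have "card F = card {I \<in> F. v \<in> I} + card ?F'"
    using \<open>finite F\<close> by (subst card_Un_disjoint[symmetric]) (auto intro: arg_cong[where f = card])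
  then have "real (card ?F') \<le> (1 - c) * card F"
    using v(2) by (simp add: algebra_simps)
  also have "\<dots> \<le> exp (- c) * card F"
    using exp_ge_add_one_self[of "- c"] by (intro mult_right_mono) auto
  also have "\<dots> < exp (- c) * exp (c * real (Suc t))"
    using Suc.prems(4) by (intro mult_strict_left_mono) auto
  also have "\<dots> = exp (c * real t)"
    by (simp add: algebra_simps flip: exp_add)
  finally obtain T where T: "T \<subseteq> V" "card T \<le> t" "\<forall>I\<in>?F'. T \<inter> I \<noteq> {}"
    using Suc.IH[of ?F'] Suc.prems(1-3) by auto
  \<comment> \<open>\<open>v\<close> hits the sets that contain it, and \<open>T\<close> hits those
    in \<open>?F'\<close>.\<close>
  have "card (insert v T) \<le> Suc t"
    using T(2) card_insert_le_m1[of "Suc t" T v] by simp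
  with T v(1) show ?case
    by (intro exI[of _ "insert v T"]) auto
qed

lemma hitting_number_le:
  assumes "finite (pverts G)" "hitting_set G T"
  shows "hitting_number G \<le> card T"
proof -
  have "{T. hitting_set G T} \<subseteq> Pow (pverts G)"
    by (auto simp: hitting_set_def)
  then have "finite {T. hitting_set G T}"
    using assms(1) finite_subset by blast
  then show ?thesis
    using assms(2) by (auto simp: hitting_number_def intro: Min_le)
qed

lemma hitting_number_le_of_few:
  fixes c :: real
  assumes fin: "finite (pverts G)" and ne: "pverts G \<noteq> {}"
    and \<alpha>: "c * card (pverts G) \<le> independence_number G"
    and few: "card {I. maximum_independent_set G I} < exp (c * real t)"
  shows "hitting_number G \<le> t"
proof -
  let ?F = "{I. maximum_independent_set G I}"
  have F: "\<And>I. I \<in> ?F \<Longrightarrow> I \<subseteq> pverts G" "\<And>I. I \<in> ?F \<Longrightarrow> c * card (pverts G) \<le> card I"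
    using \<alpha> by (auto simp: maximum_independent_set_def independent_set_def)
  have "finite ?F"
    using F(1) fin by (intro finite_subset[of ?F "Pow (pverts G)"]) blast+
  then obtain T where T: "T \<subseteq> pverts G" "card T \<le> t" "\<forall>I\<in>?F. T \<inter> I \<noteq> {}"
    using exists_small_transversal[OF fin ne _ F few] by auto
  then have "hitting_set G T"
    by (simp add: hitting_set_def)
  from hitting_number_le[OF fin this] T(2) show ?thesis
    by simp
qed

theorem theorem3:
  fixes c \<delta> :: real
  assumes "c > 0" and "\<delta> > 0"
  shows "\<exists>\<epsilon>::real. \<epsilon> > 0 \<and> (\<exists>n\<^sub>0::nat. \<forall>(G :: 'a pair_pre_digraph) n.
           pair_graph G \<longrightarrow> n = card (pverts G) \<longrightarrow> n \<ge> n\<^sub>0 \<longrightarrow>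
           real (independence_number G) \<ge> c * real n \<longrightarrow>
           real (card {I. maximum_independent_set G I}) \<le> 2 powr (\<epsilon> * real n) \<longrightarrow>
           real (hitting_number G) \<le> \<delta> * real n)"
proof (intro exI[of _ "c * \<delta> / 2"] conjI exI[of _ "nat \<lceil>2 / \<delta>\<rceil>"] allI impI)
  show "c * \<delta> / 2 > 0"
    using assms by simp
next
  fix G :: "'a pair_pre_digraph" and n
  assume "pair_graph G" and n: "n = card (pverts G)" and "nat \<lceil>2 / \<delta>\<rceil> \<le> n"
    and \<alpha>: "c * real n \<le> real (independence_number G)"
    and few: "real (card {I. maximum_independent_set G I}) \<le> 2 powr (c * \<delta> / 2 * real n)"
  define t where "t = nat \<lfloor>\<delta> * n\<rfloor>"
  have "2 / \<delta> \<le> n"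
    using \<open>nat \<lceil>2 / \<delta>\<rceil> \<le> n\<close> by linarith
  \<comment> \<open>The choice of \<open>n\<^sub>0\<close> serves this bound: rounding \<delta>n
    down loses less than 1, so at most half of \<delta>n. This is the factor 1/2 in the witness for
    \<epsilon>.\<close>
  then have n_large: "2 \<le> \<delta> * n"
    using \<open>\<delta> > 0\<close> by (simp add: field_simps)
  then have "n > 0"
    by (cases n) auto
  have t: "real t \<le> \<delta> * n" "\<delta> * n / 2 \<le> real t"
    using n_large unfolding t_def by linarith+
  \<comment> \<open>Infinite sets have \<open>card\<close> 0, so a positive \<open>card\<close>
    yields both facts.\<close>
  have V: "finite (pverts G)" "pverts G \<noteq> {}"
    using n \<open>n > 0\<close> card_gt_0_iff[of "pverts G"] by simp_all
  note few
  \<comment> \<open>Passing from base 2 to base e with a positive exponent supplies the strict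
    inequality that the greedy bound requires.\<close>
  also have "2 powr (c * \<delta> / 2 * n) < exp (c * \<delta> / 2 * n)"
    using \<open>c > 0\<close> \<open>\<delta> > 0\<close> \<open>n > 0\<close> ln_2_less_1 by (simp add: powr_def)
  also have "\<dots> \<le> exp (c * real t)"
    using mult_left_mono[OF t(2), of c] \<open>c > 0\<close> by simp
  finally have "hitting_number G \<le> t"
    using \<alpha> n by (intro hitting_number_le_of_few[OF V]) simp_all
  then show "real (hitting_number G) \<le> \<delta> * real n"
    using t(1) by linarith
qed

end
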